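(* Let $p(\mathbf{x})$ be a prior probability density on $\mathbb{R}^n$ and, for a fixed measurement $\mathbf{z}\in\mathbb{R}^m$, let $p(\mathbf{z}|\mathbf{x})$ be the measurement likelihood. Let $p(\mathbf{z})=\int p(\mathbf{z}|\mathbf{x})p(\mathbf{x})\,d\mathbf{x}$ and let $p(\mathbf{x}|\mathbf{z})=p(\mathbf{z}|\mathbf{x})p(\mathbf{x})/p(\mathbf{z})$ be the Bayes posterior. For $\lambda\in[0,1]$ define the transient density $$p(\mathbf{x}|\mathbf{z};\lambda)=\frac{p(\mathbf{z}|\mathbf{x})^{\lambda}p(\mathbf{x})}{p(\mathbf{z};\lambda)},\qquad p(\mathbf{z};\lambda)=\int p(\mathbf{z}|\mathbf{x})^{\lambda}p(\mathbf{x})\,d\mathbf{x}.$$ Then the transient density with pseudo-time scaling function $\lambda(t)=1-\exp(-t)$, i.e. $q(\mathbf{x};t):=p(\mathbf{x}|\mathbf{z};\lambda(t))$, is a solution to the Fisher-Rao gradient flow of the Kullback-Leibler divergence $$\frac{\partial q(\mathbf{x};t)}{\partial t}=-\nabla^{\mathrm{FR}}_{q}D_{KL}\big(q(\mathbf{x};t)\,\|\,p(\mathbf{x}|\mathbf{z})\big)$$ with $q(\mathbf{x};0)=p(\mathbf{x})$.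
   Context: $D_{KL}(q\|p)=\int q\log(q/p)\,d\mathbf{x}$. The flow is considered on the statistical manifold of smooth strictly positive probability densities, $\mathcal{P}=\{p\in C^\infty:\int p(\mathbf{x})\,d\mathbf{x}=1,\ p(\mathbf{x})>0\}$, equipped with the Fisher-Rao Riemannian metric $g_q(\sigma_1,\sigma_2)=\int\sigma_1(\mathbf{x})\sigma_2(\mathbf{x})/q(\mathbf{x})\,d\mathbf{x}$ for tangent vectors $\sigma_1,\sigma_2$ at $q$. The Riemannian gradient of the KL divergence with respect to this metric is $$\nabla^{\mathrm{FR}}_{q}D_{KL}(q(\mathbf{x})\,\|\,p(\mathbf{x}|\mathbf{z}))=q(\mathbf{x})\left(\log\frac{q(\mathbf{x})}{p(\mathbf{x}|\mathbf{z})}-\mathbb{E}_{q(\mathbf{x})}\left[\log\frac{q(\mathbf{x})}{p(\mathbf{x}|\mathbf{z})}\right]\right).$$ *)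

theory Defs
  imports "HOL-Analysis.Analysis"
begin

(* C^k for real-valued functions: all directional derivatives are C^(k-1). *)
primrec Ck :: "nat \<Rightarrow> ('a::euclidean_space \<Rightarrow> real) \<Rightarrow> bool" where
  "Ck 0 f \<longleftrightarrow> continuous_on UNIV f"
| "Ck (Suc k) f \<longleftrightarrow>
     f differentiable_on UNIV \<and> (\<forall>v. Ck k (\<lambda>x. frechet_derivative f (at x) v))"

definition smooth :: "('a::euclidean_space \<Rightarrow> real) \<Rightarrow> bool" where
  "smooth f \<longleftrightarrow> (\<forall>k. Ck k f)"

(* has_bochner_integral includes integrability, which LBINT alone would not. *)
definition prob_densities :: "('a::euclidean_space \<Rightarrow> real) set" where
  "prob_densities = {p. smooth p \<and> (\<forall>x. 0 < p x) \<and> has_bochner_integral lborel p 1}"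

definition tangent_vectors :: "('a::euclidean_space \<Rightarrow> real) set" where
  "tangent_vectors = {\<sigma>. smooth \<sigma> \<and> has_bochner_integral lborel \<sigma> 0}"

definition fisher_rao ::
    "('a::euclidean_space \<Rightarrow> real) \<Rightarrow> ('a \<Rightarrow> real) \<Rightarrow> ('a \<Rightarrow> real) \<Rightarrow> real" where
  "fisher_rao q \<sigma>1 \<sigma>2 = (LINT x|lborel. \<sigma>1 x * \<sigma>2 x / q x)"

(* v is the Riemannian gradient of F at q: the differential of F at q is represented by v
   under the metric. The differential is tested on the tangent vectors along which the straight
   line through q stays in the manifold near q. For q in prob_densities these include all
   compactly supported tangent vectors, so there is at most one such v. *)
definition has_fisher_rao_gradient ::
    "(('a::euclidean_space \<Rightarrow> real) \<Rightarrow> real) \<Rightarrow> ('a \<Rightarrow> real) \<Rightarrow> ('a \<Rightarrow> real) \<Rightarrow> bool" where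
  "has_fisher_rao_gradient F v q \<longleftrightarrow>
     v \<in> tangent_vectors \<and>
     (\<forall>\<sigma>\<in>tangent_vectors.
        (\<forall>\<^sub>F \<epsilon> in nhds 0. (\<lambda>x. q x + \<epsilon> * \<sigma> x) \<in> prob_densities) \<longrightarrow>
        ((\<lambda>\<epsilon>. F (\<lambda>x. q x + \<epsilon> * \<sigma> x)) has_real_derivative fisher_rao q v \<sigma>) (at 0))"

definition expect :: "('a::euclidean_space \<Rightarrow> real) \<Rightarrow> ('a \<Rightarrow> real) \<Rightarrow> real" where
  "expect q f = (LINT x|lborel. q x * f x)"

definition KL :: "('a::euclidean_space \<Rightarrow> real) \<Rightarrow> ('a \<Rightarrow> real) \<Rightarrow> real" where
  "KL q p = (LINT x|lborel. q x * ln (q x / p x))"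

(* KL defaults to 0 when the integrand is not integrable. *)
definition KL_finite :: "('a::euclidean_space \<Rightarrow> real) \<Rightarrow> ('a \<Rightarrow> real) \<Rightarrow> bool" where
  "KL_finite q p \<longleftrightarrow> integrable lborel (\<lambda>x. q x * ln (q x / p x))"

definition grad_KL :: "('a::euclidean_space \<Rightarrow> real) \<Rightarrow> ('a \<Rightarrow> real) \<Rightarrow> 'a \<Rightarrow> real" where
  "grad_KL q p x = q x * (ln (q x / p x) - expect q (\<lambda>y. ln (q y / p y)))"

(* At a boundary point of the time interval T the time derivative is one-sided. *)
definition fisher_rao_KL_flow ::
    "real set \<Rightarrow> (real \<Rightarrow> 'a::euclidean_space \<Rightarrow> real) \<Rightarrow> ('a \<Rightarrow> real) \<Rightarrow> bool" where
  "fisher_rao_KL_flow T q p \<longleftrightarrow>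
     (\<forall>t\<in>T. q t \<in> prob_densities \<and> KL_finite (q t) p \<and>
        has_fisher_rao_gradient (\<lambda>r. KL r p) (grad_KL (q t) p) (q t) \<and>
        (\<forall>x. ((\<lambda>s. q s x) has_real_derivative - grad_KL (q t) p x) (at t within T)))"

(* In the following, lik z x stands for the likelihood p(z|x). *)

definition evidence :: "('b \<Rightarrow> 'a::euclidean_space \<Rightarrow> real) \<Rightarrow> ('a \<Rightarrow> real) \<Rightarrow> 'b \<Rightarrow> real" where
  "evidence lik prior z = (LINT x|lborel. lik z x * prior x)"

definition posterior ::
    "('b \<Rightarrow> 'a::euclidean_space \<Rightarrow> real) \<Rightarrow> ('a \<Rightarrow> real) \<Rightarrow> 'b \<Rightarrow> 'a \<Rightarrow> real" where
  "posterior lik prior z x = lik z x * prior x / evidence lik prior z"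

definition transient_evidence ::
    "('b \<Rightarrow> 'a::euclidean_space \<Rightarrow> real) \<Rightarrow> ('a \<Rightarrow> real) \<Rightarrow> 'b \<Rightarrow> real \<Rightarrow> real" where
  "transient_evidence lik prior z l = (LINT x|lborel. lik z x powr l * prior x)"

definition transient ::
    "('b \<Rightarrow> 'a::euclidean_space \<Rightarrow> real) \<Rightarrow> ('a \<Rightarrow> real) \<Rightarrow> 'b \<Rightarrow> real \<Rightarrow> 'a \<Rightarrow> real" where
  "transient lik prior z l x = lik z x powr l * prior x / transient_evidence lik prior z l"

definition pseudo_time :: "real \<Rightarrow> real" where
  "pseudo_time t = 1 - exp (- t)"

end

theory Submission
  imports Defs
begin

text \<open>
  With \<open>l = pseudo_time t\<close> one has \<open>ln (q / p) = (l - 1) ln L + const\<close> for the likelihood \<open>L\<close>,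
  and \<open>d l / d t = 1 - l\<close>. So the logarithmic time derivative of \<open>q\<close> is \<open>ln (q / p)\<close> recentred
  and negated. All interchanges of derivative and integral are by domination: for \<open>0 < l < 1\<close> the
  function \<open>L powr l * \<bar>ln L\<bar>\<close> is at most \<open>1 / l + L / (1 - l)\<close>, while at \<open>l = 0\<close>
  finiteness of the divergence provides the bound. For the gradient of the
  divergence, a direction \<open>\<sigma>\<close> with \<open>q + \<epsilon> \<sigma> > 0\<close> for small \<open>\<bar>\<epsilon>\<bar>\<close> satisfies \<open>\<bar>\<sigma>\<bar> \<le> C q\<close>.
\<close>

section \<open>Closure properties of C^k and smooth functions\<close>

lemma Ck_SucI:
  assumes "\<And>x. (f has_derivative D x) (at x)" and "\<And>v. Ck k (\<lambda>x. D x v)"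
  shows "Ck (Suc k) f"
proof -
  have "frechet_derivative f (at x) = D x" for x
    using frechet_derivative_at[OF assms(1)] by simp
  with assms show ?thesis
    by (auto simp: differentiable_on_def differentiable_def intro: has_derivative_at_withinI)
qed

lemma Ck_Suc_has_derivative:
  assumes "Ck (Suc k) f"
  shows "(f has_derivative frechet_derivative f (at x)) (at x)"
  using assms by (simp add: differentiable_on_def frechet_derivative_works[symmetric])

lemma Ck_SucD: "Ck (Suc k) f \<Longrightarrow> Ck k f"
proof (induction k arbitrary: f)
  case 0
  then show ?case by (simp add: differentiable_imp_continuous_on)
next
  case (Suc k)
  then show ?case by (metis Ck.simps(2))
qed

lemma Ck_const: "Ck k (\<lambda>x. c)"
proof (induction k arbitrary: c)
  case (Suc k)
  show ?case by (rule Ck_SucI[where D="\<lambda>x v. 0"]) (auto intro: Suc)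
qed simp

lemma Ck_add: "Ck k f \<Longrightarrow> Ck k g \<Longrightarrow> Ck k (\<lambda>x. f x + g x)"
proof (induction k arbitrary: f g)
  case (Suc k)
  show ?case
    by (rule Ck_SucI, rule has_derivative_add[OF Ck_Suc_has_derivative[OF Suc.prems(1)]
          Ck_Suc_has_derivative[OF Suc.prems(2)]])
      (use Suc in auto)
qed (auto intro: continuous_intros)

text \<open>The product rule keeps \<open>f\<close> and \<open>g\<close> themselves next to the
  derivatives. They are needed only at level \<open>k\<close>, which \<open>Ck_SucD\<close>
  supplies.\<close>

lemma Ck_mult: "Ck k f \<Longrightarrow> Ck k g \<Longrightarrow> Ck k (\<lambda>x. f x * g x)"
proof (induction k arbitrary: f g)
  case (Suc k)
  show ?case
    by (rule Ck_SucI, rule has_derivative_mult[OF Ck_Suc_has_derivative[OF Suc.prems(1)]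
          Ck_Suc_has_derivative[OF Suc.prems(2)]])
      (use Suc in \<open>auto intro!: Ck_add Suc.IH dest: Ck_SucD simp del: Ck.simps(2),
        auto\<close>)
qed (auto intro: continuous_intros)

text \<open>The exponent stays arbitrary in the induction because differentiation lowers it to
  \<open>a - 1\<close>.\<close>

lemma Ck_powr:
  assumes pos: "\<And>x. 0 < f x"
  shows "Ck k f \<Longrightarrow> Ck k (\<lambda>x. f x powr a)"
proof (induction k arbitrary: a)
  case 0
  then show ?case using pos by (auto intro!: continuous_intros simp: less_imp_neq[symmetric])
next
  case (Suc k)
  let ?D = "\<lambda>x v. a * f x powr (a - 1) * frechet_derivative f (at x) v"
  have "((\<lambda>y. y powr a) has_derivative (\<lambda>h. a * f x powr (a - 1) * h)) (at (f x))" for x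
    using has_real_derivative_powr[OF pos, of a x] unfolding has_field_derivative_def .
  then have "((\<lambda>x. f x powr a) has_derivative ?D x) (at x)" for x
    using has_derivative_compose[OF Ck_Suc_has_derivative[OF Suc.prems]] by blast
  moreover have "Ck k (\<lambda>x. ?D x v)" for v
    using Suc.prems by (intro Ck_mult Ck_const Suc.IH[OF Ck_SucD]) auto
  ultimately show ?case by (rule Ck_SucI)
qed

text \<open>A case split suffices: the derivative contains no logarithm, only the reciprocal of
  \<open>f\<close>, written as a power so that \<open>Ck_powr\<close> applies.\<close>

lemma Ck_ln:
  assumes pos: "\<And>x. 0 < f x" and f: "Ck k f"
  shows "Ck k (\<lambda>x. ln (f x))"
proof (cases k)
  case 0
  then show ?thesis using assms by (auto intro!: continuous_intros simp: less_imp_neq[symmetric])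
next
  case (Suc j)
  let ?D = "\<lambda>x v. f x powr (-1) * frechet_derivative f (at x) v"
  have f': "Ck (Suc j) f" using f Suc by simp
  have "(ln has_derivative (\<lambda>h. f x powr (-1) * h)) (at (f x))" for x
    using DERIV_ln_divide[OF pos, of x] pos[of x]
    unfolding has_field_derivative_def powr_minus_divide by (simp only: powr_one less_imp_le)
  then have "((\<lambda>x. ln (f x)) has_derivative ?D x) (at x)" for x
    using has_derivative_compose[OF Ck_Suc_has_derivative[OF f']] by blast
  moreover have "Ck j (\<lambda>x. ?D x v)" for v
    using f' by (intro Ck_mult Ck_powr[OF pos Ck_SucD]) auto
  ultimately show ?thesis unfolding Suc by (rule Ck_SucI)
qed

lemma smooth_const: "smooth (\<lambda>x. c)"
  and smooth_add: "smooth f \<Longrightarrow> smooth g \<Longrightarrow> smooth (\<lambda>x. f x + g x)"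
  and smooth_mult: "smooth f \<Longrightarrow> smooth g \<Longrightarrow> smooth (\<lambda>x. f x * g x)"
  and smooth_powr: "(\<And>x. 0 < f x) \<Longrightarrow> smooth f \<Longrightarrow> smooth (\<lambda>x. f x powr a)"
  and smooth_ln: "(\<And>x. 0 < f x) \<Longrightarrow> smooth f \<Longrightarrow> smooth (\<lambda>x. ln (f x))"
  by (auto simp: smooth_def intro: Ck_const Ck_add Ck_mult Ck_powr Ck_ln)

lemma smooth_diff:
  assumes "smooth f" "smooth g"
  shows "smooth (\<lambda>x. f x - g x)"
  using smooth_add[OF assms(1) smooth_mult[OF smooth_const[of "-1"] assms(2)]] by simp

lemma smooth_divide:
  assumes "smooth f" "smooth g" and pos: "\<And>x. 0 < g x"
  shows "smooth (\<lambda>x. f x / g x)"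
  using smooth_mult[OF assms(1) smooth_powr[OF pos assms(2), of "-1"]] pos
  by (simp add: powr_minus_divide less_imp_le)

lemma smooth_borel_measurable:
  "smooth (f :: 'a::euclidean_space \<Rightarrow> real) \<Longrightarrow> f \<in> borel_measurable borel"
  by (metis smooth_def Ck.simps(1) borel_measurable_continuous_onI)

section \<open>Differentiation under the integral sign\<close>

lemma has_real_derivative_integral:
  fixes f f' :: "real \<Rightarrow> 'a \<Rightarrow> real"
  assumes T: "convex T" "t \<in> T"
    and f_meas: "\<And>s. s \<in> T \<Longrightarrow> f s \<in> borel_measurable M"
    and f_int: "integrable M (f t)"
    and deriv: "\<And>s x. s \<in> T \<Longrightarrow> ((\<lambda>s. f s x) has_real_derivative f' s x) (at s within T)"
    and bound: "\<And>s x. s \<in> T \<Longrightarrow> \<bar>f' s x\<bar> \<le> w x"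
    and w: "integrable M w"
    and f'_meas: "f' t \<in> borel_measurable M"
  shows "((\<lambda>s. LINT x|M. f s x) has_real_derivative (LINT x|M. f' t x)) (at t within T)"
proof -
  \<comment> \<open>The mean value inequality on the convex set \<open>T\<close> gives a Lipschitz
    bound that serves twice: for integrability of each \<open>f s\<close> and for dominating the
    difference quotients.\<close>
  have lip: "\<bar>f s x - f t x\<bar> \<le> w x * \<bar>s - t\<bar>" if "s \<in> T" for s x
    using field_differentiable_bound[OF T(1) deriv, of x "w x" s t] bound that T(2) by simp
  have int: "integrable M (f s)" if s: "s \<in> T" for s
  proof (rule Bochner_Integration.integrable_bound)
    show "integrable M (\<lambda>x. \<bar>f t x\<bar> + w x * \<bar>s - t\<bar>)"
      using f_int w by simp
    show "AE x in M. norm (f s x) \<le> norm (\<bar>f t x\<bar> + w x * \<bar>s - t\<bar>)"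
      using lip[OF s] by (intro AE_I2) (smt (verit) real_norm_def)
  qed (rule f_meas[OF s])
  \<comment> \<open>Dominated convergence concerns sequences, so the limit is tested along sequences
    in \<open>T - {t}\<close>. This includes one-sided derivatives at an endpoint of
    \<open>T\<close>.\<close>
  show ?thesis
    unfolding has_field_derivative_iff tendsto_at_iff_sequentially o_def
  proof (intro allI impI)
    fix X :: "nat \<Rightarrow> real"
    assume X: "\<forall>i. X i \<in> T - {t}" and lim: "X \<longlonglongrightarrow> t"
    have "(\<lambda>i. LINT x|M. (f (X i) x - f t x) / (X i - t)) \<longlonglongrightarrow> (LINT x|M. f' t x)"
    proof (rule integral_dominated_convergence)
      show "AE x in M. (\<lambda>i. (f (X i) x - f t x) / (X i - t)) \<longlonglongrightarrow> f' t x"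
        using deriv[OF T(2)] X lim
        unfolding has_field_derivative_iff tendsto_at_iff_sequentially o_def by blast
      show "AE x in M. norm ((f (X i) x - f t x) / (X i - t)) \<le> w x" for i
      proof (intro AE_I2)
        fix x
        have "X i \<in> T" "X i \<noteq> t" using X by auto
        then show "norm ((f (X i) x - f t x) / (X i - t)) \<le> w x"
          using lip[of "X i" x] by (simp add: abs_divide divide_le_eq)
      qed
      show "(\<lambda>x. (f (X i) x - f t x) / (X i - t)) \<in> borel_measurable M" for i
        using X f_meas T(2) by (intro borel_measurable_divide borel_measurable_diff) auto
    qed (use w f'_meas in auto)
    then show "(\<lambda>i. ((LINT x|M. f (X i) x) - (LINT x|M. f t x)) / (X i - t)) \<longlonglongrightarrow> (LINT x|M. f' t x)"
      using X int T(2) by simp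
  qed
qed

section \<open>The Fisher-Rao gradient of the KL divergence\<close>

lemma prob_densitiesD:
  assumes "q \<in> prob_densities"
  shows "smooth q" "\<And>x. 0 < q x" "integrable lborel q" "integral\<^sup>L lborel q = 1"
  using assms by (auto simp: prob_densities_def has_bochner_integral_iff)

text \<open>Recentring by the mean \<open>?E\<close> gives total integral
  \<open>?E - ?E * 1\<close>, since \<open>q\<close> has mass 1. Finiteness of the divergence makes
  \<open>?E\<close> a genuine integral and not the default 0.\<close>

lemma grad_KL_tangent:
  assumes q: "q \<in> prob_densities" and p: "smooth p" "\<And>x. 0 < p x" and fin: "KL_finite q p"
  shows "grad_KL q p \<in> tangent_vectors"
proof -
  note q = prob_densitiesD[OF q]
  let ?E = "expect q (\<lambda>y. ln (q y / p y))"
  have "smooth (grad_KL q p)"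
    unfolding grad_KL_def[abs_def]
    by (intro smooth_mult smooth_diff smooth_ln smooth_const smooth_divide)
      (use q p in auto)
  moreover have "has_bochner_integral lborel (\<lambda>x. q x * ln (q x / p x) - ?E * q x) (?E - ?E * 1)"
    using fin q(3,4) unfolding KL_finite_def expect_def
    by (intro has_bochner_integral_diff has_bochner_integral_mult_right)
      (auto simp: has_bochner_integral_iff)
  ultimately show ?thesis
    by (simp add: tangent_vectors_def grad_KL_def[abs_def] algebra_simps)
qed

text \<open>Use \<open>ln v \<le> v - 1\<close> with \<open>v = u\<close> and with
  \<open>v = 1 / u\<close>.\<close>

lemma abs_ln_le_one:
  assumes "1 / 2 \<le> u" "u \<le> 3 / 2"
  shows "\<bar>ln u\<bar> \<le> (1 :: real)"
proof -
  have "ln u \<le> u - 1" using assms by (intro ln_le_minus_one) auto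
  moreover have "ln (1 / u) \<le> 1 / u - 1" using assms by (intro ln_le_minus_one) auto
  moreover have "1 / u \<le> 2" using assms by (simp add: divide_le_eq)
  ultimately show ?thesis using assms by (simp add: ln_div)
qed

text \<open>The derivative along \<sigma> is the integral of
  \<open>\<sigma> * ln (q / p) + \<sigma>\<close>. In the metric the factor \<open>q\<close> of the
  gradient cancels, leaving \<open>\<sigma> * ln (q / p) - ?E * \<sigma>\<close>. Both integrals
  agree because \<sigma> has integral 0.\<close>

lemma has_fisher_rao_gradient_KL:
  fixes q p :: "'a::euclidean_space \<Rightarrow> real"
  assumes q_dens: "q \<in> prob_densities" and p: "smooth p" "\<And>x. 0 < p x" and fin: "KL_finite q p"
  shows "has_fisher_rao_gradient (\<lambda>r. KL r p) (grad_KL q p) q"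
  unfolding has_fisher_rao_gradient_def
proof (intro conjI ballI impI)
  note q = prob_densitiesD[OF q_dens]
  show "grad_KL q p \<in> tangent_vectors"
    by (rule grad_KL_tangent[OF assms])
  fix \<sigma> :: "'a \<Rightarrow> real"
  assume \<sigma>: "\<sigma> \<in> tangent_vectors"
    and ev: "\<forall>\<^sub>F \<epsilon> in nhds 0. (\<lambda>x. q x + \<epsilon> * \<sigma> x) \<in> prob_densities"
  have \<sigma>_int: "integrable lborel \<sigma>" "integral\<^sup>L lborel \<sigma> = 0" and \<sigma>_smooth: "smooth \<sigma>"
    using \<sigma> by (auto simp: tangent_vectors_def has_bochner_integral_iff)
  note [measurable] = smooth_borel_measurable[OF q(1)] smooth_borel_measurable[OF p(1)]
    smooth_borel_measurable[OF \<sigma>_smooth]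
  obtain d where d: "0 < d" "\<And>\<epsilon>. \<bar>\<epsilon>\<bar> < d \<Longrightarrow> (\<lambda>x. q x + \<epsilon> * \<sigma> x) \<in> prob_densities"
    using ev by (auto simp: eventually_nhds_metric dist_real_def)
  define e where "e = d / 2"
  have e: "0 < e" "\<bar>e\<bar> < d" "\<bar>- e\<bar> < d" using d(1) by (auto simp: e_def)
  \<comment> \<open>Positivity of \<open>q + \<epsilon> * \<sigma>\<close> at
    \<open>\<epsilon> = e\<close> and at \<open>\<epsilon> = - e\<close>; one of the two signs is
    informative at each \<open>x\<close>.\<close>
  have \<sigma>_le: "e * \<bar>\<sigma> x\<bar> \<le> q x" for x
    using prob_densitiesD(2)[OF d(2)[OF e(2)], of x] prob_densitiesD(2)[OF d(2)[OF e(3)], of x] e(1)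
    by (cases "0 \<le> \<sigma> x") auto
  \<comment> \<open>Halving \<open>e\<close> keeps the ratio of perturbed to unperturbed density in
    [1/2, 3/2]; at \<open>e\<close> itself it could come arbitrarily close to 0.\<close>
  define T where "T = {- (e / 2)..e / 2}"
  have ratio: "1 / 2 \<le> (q x + \<epsilon> * \<sigma> x) / q x" "(q x + \<epsilon> * \<sigma> x) / q x \<le> 3 / 2"
    if "\<epsilon> \<in> T" for \<epsilon> x
  proof -
    have "\<bar>\<epsilon> * \<sigma> x\<bar> \<le> e / 2 * \<bar>\<sigma> x\<bar>"
      unfolding abs_mult using that by (intro mult_right_mono) (auto simp: T_def)
    with \<sigma>_le[of x] have "\<bar>\<epsilon> * \<sigma> x\<bar> \<le> q x / 2" by simp
    then show "1 / 2 \<le> (q x + \<epsilon> * \<sigma> x) / q x" "(q x + \<epsilon> * \<sigma> x) / q x \<le> 3 / 2"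
      using q(2)[of x] by (auto simp: field_simps abs_le_iff)
  qed
  have pos: "0 < q x + \<epsilon> * \<sigma> x" if "\<epsilon> \<in> T" for \<epsilon> x
    using ratio(1)[OF that, of x] q(2)[of x] by (simp add: field_simps)
  have ln_le: "\<bar>ln ((q x + \<epsilon> * \<sigma> x) / p x)\<bar> \<le> \<bar>ln (q x / p x)\<bar> + 1" if "\<epsilon> \<in> T" for \<epsilon> x
  proof -
    have "ln ((q x + \<epsilon> * \<sigma> x) / p x) = ln (q x / p x) + ln ((q x + \<epsilon> * \<sigma> x) / q x)"
      using pos[OF that, of x] q(2)[of x] p(2)[of x] by (simp add: ln_div)
    then show ?thesis using abs_ln_le_one[OF ratio[OF that, of x]] by linarith
  qed
  have qln: "integrable lborel (\<lambda>x. q x * \<bar>ln (q x / p x)\<bar>)"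
    using integrable_abs[OF fin[unfolded KL_finite_def]] q(2)
    by (simp add: abs_mult less_imp_le)
  define f where "f = (\<lambda>\<epsilon> x. (q x + \<epsilon> * \<sigma> x) * ln ((q x + \<epsilon> * \<sigma> x) / p x))"
  define f' where "f' = (\<lambda>\<epsilon> x. \<sigma> x * ln ((q x + \<epsilon> * \<sigma> x) / p x) + \<sigma> x)"
  \<comment> \<open>Of the two extra copies of \<open>q\<close>, one pays for the change of the
    logarithm (\<open>ln_le\<close>) and one for the summand \<sigma> in \<open>f'\<close>; the
    factor \<open>1 / e\<close> comes from \<open>\<sigma>_le\<close>.\<close>
  define w where "w = (\<lambda>x. (q x * \<bar>ln (q x / p x)\<bar> + 2 * q x) / e)"
  have T: "convex T" "0 \<in> T" "0 \<in> interior T" using e by (auto simp: T_def)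
  have "((\<lambda>\<epsilon>. LINT x|lborel. f \<epsilon> x) has_real_derivative (LINT x|lborel. f' 0 x)) (at 0 within T)"
  proof (rule has_real_derivative_integral[OF T(1,2)])
    show "integrable lborel (f 0)" using fin by (simp add: f_def KL_finite_def)
    show "((\<lambda>s. f s x) has_real_derivative f' s x) (at s within T)" if "s \<in> T" for s x
    proof -
      have lin: "((\<lambda>s. q x + s * \<sigma> x) has_real_derivative \<sigma> x) (at s within T)"
        by (auto intro!: derivative_eq_intros)
      have u: "0 < (q x + s * \<sigma> x) / p x" using pos[OF that, of x] p(2)[of x] by simp
      from DERIV_mult[OF lin DERIV_chain2[OF DERIV_ln_divide[OF u] DERIV_cdivide[OF lin]]]
      show ?thesis
        unfolding f_def f'_def using pos[OF that, of x] p(2)[of x] by (simp add: mult.commute)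
    qed
    show "\<bar>f' s x\<bar> \<le> w x" if "s \<in> T" for s x
    proof -
      have "f' s x = \<sigma> x * (ln ((q x + s * \<sigma> x) / p x) + 1)" by (simp add: f'_def algebra_simps)
      then have "\<bar>f' s x\<bar> \<le> \<bar>\<sigma> x\<bar> * (\<bar>ln (q x / p x)\<bar> + 2)"
        using ln_le[OF that, of x] unfolding abs_mult by (auto intro!: mult_left_mono simp: abs_mult)
      also have "\<dots> \<le> q x / e * (\<bar>ln (q x / p x)\<bar> + 2)"
        using \<sigma>_le[of x] e(1) by (intro mult_right_mono) (auto simp: field_simps)
      also have "\<dots> = w x" by (simp add: w_def field_simps)
      finally show ?thesis .
    qed
    show "integrable lborel w" unfolding w_def using qln q(3) by simp
  qed (auto simp: f_def f'_def)
  \<comment> \<open>As 0 is interior to \<open>T\<close>, the derivative within \<open>T\<close> is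
    the full derivative.\<close>
  then have D: "((\<lambda>\<epsilon>. KL (\<lambda>x. q x + \<epsilon> * \<sigma> x) p) has_real_derivative (LINT x|lborel. f' 0 x)) (at 0)"
    by (simp add: at_within_interior[OF T(3)] KL_def f_def)
  let ?E = "expect q (\<lambda>y. ln (q y / p y))"
  have \<sigma>ln: "integrable lborel (\<lambda>x. \<sigma> x * ln (q x / p x))"
  proof (rule Bochner_Integration.integrable_bound)
    show "integrable lborel (\<lambda>x. q x * \<bar>ln (q x / p x)\<bar> / e)" using qln by simp
    have "\<bar>\<sigma> x\<bar> \<le> q x / e" for x using \<sigma>_le[of x] e(1) by (simp add: field_simps)
    then show "AE x in lborel. norm (\<sigma> x * ln (q x / p x)) \<le> norm (q x * \<bar>ln (q x / p x)\<bar> / e)"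
      using e(1) q(2) mult_right_mono[OF _ abs_ge_zero]
      by (intro AE_I2) (fastforce simp: abs_mult less_imp_le)
  qed simp
  have "fisher_rao q (grad_KL q p) \<sigma> = (LINT x|lborel. \<sigma> x * ln (q x / p x) - ?E * \<sigma> x)"
    unfolding fisher_rao_def grad_KL_def using q(2)
    by (intro Bochner_Integration.integral_cong) (auto simp: less_imp_neq[symmetric] field_simps)
  also have "\<dots> = (LINT x|lborel. \<sigma> x * ln (q x / p x))" using \<sigma>ln \<sigma>_int by simp
  also have "\<dots> = (LINT x|lborel. f' 0 x)" using \<sigma>ln \<sigma>_int by (simp add: f'_def)
  finally show "((\<lambda>\<epsilon>. KL (\<lambda>x. q x + \<epsilon> * \<sigma> x) p) has_real_derivative fisher_rao q (grad_KL q p) \<sigma>) (at 0)"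
    using D by simp
qed

section \<open>Powers as functions of their exponent\<close>

lemma has_real_derivative_powr_exponent:
  assumes "0 < (c :: real)"
  shows "((\<lambda>s. c powr s) has_real_derivative c powr s * ln c) (at s within T)"
  unfolding powr_def using assms by (auto intro!: derivative_eq_intros)

text \<open>Apply \<open>ln y \<le> y - 1\<close> to \<open>y = L powr - l\<close> when
  \<open>ln L\<close> is negative and to \<open>y = L powr (1 - l)\<close> when it is positive.
  Multiplied by \<open>L powr l\<close>, these become 1 and \<open>L\<close>.\<close>

lemma powr_times_abs_ln_le:
  assumes "0 < L" "0 < l" "l < 1"
  shows "L powr l * \<bar>ln L\<bar> \<le> 1 / l + L / (1 - l :: real)"
proof -
  have "ln (L powr - l) \<le> L powr - l - 1" by (rule ln_le_minus_one) (use assms in simp)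
  then have "L powr l * (l * (- ln L)) \<le> L powr l * L powr - l"
    using assms by (intro mult_left_mono) auto
  then have 1: "L powr l * (- ln L) \<le> 1 / l"
    using assms by (simp add: powr_minus field_simps)
  have "ln (L powr (1 - l)) \<le> L powr (1 - l) - 1" by (rule ln_le_minus_one) (use assms in simp)
  then have "L powr l * ((1 - l) * ln L) \<le> L powr l * L powr (1 - l)"
    using assms by (intro mult_left_mono) auto
  then have 2: "L powr l * ln L \<le> L / (1 - l)"
    using assms by (simp add: powr_add[symmetric] field_simps)
  have "0 \<le> 1 / l" "0 \<le> L / (1 - l)" using assms by auto
  moreover have "L powr l * \<bar>ln L\<bar> = \<bar>L powr l * ln L\<bar>" by (simp add: abs_mult)
  ultimately show ?thesis using 1 2 by linarith
qed

text \<open>The power is monotone in the exponent, in a direction that depends on whether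
  \<open>1 \<le> L\<close>. The sum of both endpoint values covers either case and does not depend
  on \<open>s\<close>.\<close>

lemma powr_between_le:
  assumes "0 < L" "a \<le> s" "s \<le> b"
  shows "L powr s \<le> L powr a + L powr (b :: real)"
proof (cases "1 \<le> L")
  case True
  then have "L powr s \<le> L powr b" using assms by (intro powr_mono)
  then show ?thesis by (simp add: add_increasing)
next
  case False
  then have "L powr s \<le> L powr a" using assms by (intro powr_mono') auto
  then show ?thesis by (simp add: add_increasing2)
qed

section \<open>Transient densities for a fixed measurement\<close>

locale bayes =
  fixes lik :: "'b \<Rightarrow> 'a::euclidean_space \<Rightarrow> real" and prior :: "'a \<Rightarrow> real" and z :: 'b
  assumes prior: "prior \<in> prob_densities"
    and lik_smooth: "smooth (lik z)"
    and lik_pos: "\<And>x. 0 < lik z x"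
    and evidence_finite: "integrable lborel (\<lambda>x. lik z x * prior x)"
begin

abbreviation "Z \<equiv> transient_evidence lik prior z"

lemmas prior_smooth = prob_densitiesD(1)[OF prior]
lemmas prior_pos = prob_densitiesD(2)[OF prior]
lemmas prior_int = prob_densitiesD(3,4)[OF prior]

lemma measurable_lik [measurable]: "lik z \<in> borel_measurable borel"
  and measurable_prior [measurable]: "prior \<in> borel_measurable borel"
  by (auto intro: smooth_borel_measurable lik_smooth prior_smooth)

text \<open>The exponents 0 and 1 in \<open>powr_between_le\<close> give one majorant for all
  \<open>l\<close>, integrable by the mass of the prior and the finite evidence.\<close>

lemma tempered_le: "0 \<le> l \<Longrightarrow> l \<le> 1 \<Longrightarrow> lik z x powr l * prior x \<le> prior x + lik z x * prior x"
  using mult_right_mono[OF powr_between_le[OF lik_pos, of 0 l 1 x] less_imp_le[OF prior_pos]] lik_pos[of x]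
  by (simp add: algebra_simps)

lemma tempered_integrable:
  assumes "0 \<le> l" "l \<le> 1"
  shows "integrable lborel (\<lambda>x. lik z x powr l * prior x)"
  by (rule Bochner_Integration.integrable_bound[OF
        Bochner_Integration.integrable_add[OF prior_int(1) evidence_finite]])
    (use tempered_le[OF assms] prior_pos in
      \<open>auto intro!: order_trans[OF _ abs_ge_self] simp: abs_mult less_imp_le\<close>)

text \<open>If the integral vanished, the strictly positive integrand would be zero almost
  everywhere, although the whole space is not a null set.\<close>

lemma Z_pos:
  assumes "0 \<le> l" "l \<le> 1"
  shows "0 < Z l"
proof -
  have pos: "0 < lik z x powr l * prior x" for x
    using lik_pos[of x] prior_pos[of x] by simp
  have "Z l \<noteq> 0"
  proof
    assume "Z l = 0"
    then have "AE x in lborel. lik z x powr l * prior x = 0"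
      unfolding transient_evidence_def
      by (subst (asm) integral_nonneg_eq_0_iff_AE)
        (use tempered_integrable[OF assms] pos less_imp_le in auto)
    moreover have "\<And>x. lik z x powr l * prior x \<noteq> 0"
      using pos less_irrefl by metis
    ultimately have "AE x in (lborel :: 'a measure). False"
      by (simp only:)
    then show False by (simp add: AE_iff_null null_sets_def)
  qed
  moreover have "0 \<le> Z l" unfolding transient_evidence_def
    using pos by (intro integral_nonneg_AE AE_I2 less_imp_le)
  ultimately show ?thesis by simp
qed

lemma Z_0: "Z 0 = 1" and Z_1: "Z 1 = evidence lik prior z"
  using lik_pos prior_int
  by (auto simp: transient_evidence_def evidence_def less_imp_le less_imp_neq[symmetric]
      intro!: Bochner_Integration.integral_cong)

lemma transient_prob_density:
  assumes l: "0 \<le> l" "l \<le> 1"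
  shows "transient lik prior z l \<in> prob_densities"
proof -
  have "smooth (transient lik prior z l)"
    unfolding transient_def[abs_def]
    by (intro smooth_divide smooth_mult smooth_powr smooth_const lik_smooth prior_smooth lik_pos
        Z_pos[OF l])
  moreover have "0 < transient lik prior z l x" for x
    unfolding transient_def using Z_pos[OF l] lik_pos[of x] prior_pos[of x] by simp
  moreover have "has_bochner_integral lborel (transient lik prior z l) (Z l / Z l)"
    unfolding transient_def[abs_def] using tempered_integrable[OF l]
    by (intro has_bochner_integral_divide) (auto simp: has_bochner_integral_iff transient_evidence_def)
  ultimately show ?thesis using Z_pos[OF l] by (auto simp: prob_densities_def)
qed

text \<open>The posterior is the end point of the transient family, so smoothness and positivity
  carry over and the prior cancels in the quotient \<open>q / p\<close>.\<close>

lemma posterior_eq_transient: "posterior lik prior z = transient lik prior z 1"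
  using lik_pos by (auto simp: posterior_def transient_def Z_1 less_imp_le)

lemma ln_transient_posterior:
  assumes l: "0 \<le> l" "l \<le> 1"
  shows "ln (transient lik prior z l x / posterior lik prior z x) = (l - 1) * ln (lik z x) + ln (Z 1 / Z l)"
  unfolding posterior_eq_transient transient_def
  using Z_pos[OF l] Z_pos[of 1] lik_pos[of x] prior_pos[of x]
  by (simp add: ln_div ln_mult algebra_simps)

section \<open>Finiteness of the divergence and the time derivative\<close>

lemma KL_finite_iff:
  assumes l: "0 \<le> l" "l < 1"
  shows "KL_finite (transient lik prior z l) (posterior lik prior z) \<longleftrightarrow>
    integrable lborel (\<lambda>x. lik z x powr l * ln (lik z x) * prior x)" (is "_ \<longleftrightarrow> integrable _ ?g")
proof -
  let ?c = "(l - 1) / Z l" and ?h = "\<lambda>x. ln (Z 1 / Z l) * transient lik prior z l x"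
  have eq: "transient lik prior z l x * ln (transient lik prior z l x / posterior lik prior z x)
      = ?c * ?g x + ?h x" for x
    using l by (subst ln_transient_posterior) (auto simp: transient_def algebra_simps add_divide_distrib diff_divide_distrib)
  have h: "integrable lborel ?h"
    using prob_densitiesD(3)[OF transient_prob_density, of l] l by simp
  \<comment> \<open>Here \<open>l < 1\<close> enters: at \<open>l = 1\<close> the coefficient
    vanishes and a finite divergence says nothing about \<open>?g\<close>.\<close>
  have c: "?c \<noteq> 0" using Z_pos[of l] l by simp
  show ?thesis unfolding KL_finite_def eq
  proof
    assume "integrable lborel (\<lambda>x. ?c * ?g x + ?h x)"
    from Bochner_Integration.integrable_diff[OF this h]
    have "integrable lborel (\<lambda>x. ?c * ?g x)" by simp
    then show "integrable lborel ?g" unfolding integrable_mult_left_iff using c by blast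
  next
    assume "integrable lborel ?g"
    then show "integrable lborel (\<lambda>x. ?c * ?g x + ?h x)"
      by (intro Bochner_Integration.integrable_add h integrable_mult_right)
  qed
qed

text \<open>The bound of \<open>powr_times_abs_ln_le\<close> is integrable against the prior. It
  degenerates as \<open>l\<close> approaches 0 or 1.\<close>

lemma tempered_ln_integrable:
  assumes l: "0 < l" "l < 1"
  shows "integrable lborel (\<lambda>x. lik z x powr l * ln (lik z x) * prior x)"
proof (rule Bochner_Integration.integrable_bound)
  show "integrable lborel (\<lambda>x. prior x / l + lik z x * prior x / (1 - l))"
    using prior_int evidence_finite by simp
  have "\<bar>lik z x powr l * ln (lik z x) * prior x\<bar> \<le> prior x / l + lik z x * prior x / (1 - l)" for x
    using mult_right_mono[OF powr_times_abs_ln_le[OF lik_pos l, of x] less_imp_le[OF prior_pos[of x]]]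
      prior_pos[of x]
    by (simp add: abs_mult algebra_simps)
  then show "AE x in lborel. norm (lik z x powr l * ln (lik z x) * prior x) \<le>
      norm (prior x / l + lik z x * prior x / (1 - l))"
    by (intro AE_I2) (auto intro: order_trans[OF _ abs_ge_self])
qed simp

text \<open>On \<open>{a..b}\<close> the differentiated integrands are dominated by those at the two
  end points. Integrability at \<open>a\<close> is a hypothesis so that \<open>a = 0\<close> is
  covered as well.\<close>

lemma Z_has_derivative:
  assumes a: "0 \<le> a" "a \<le> l" "l < 1"
    and int_a: "integrable lborel (\<lambda>x. lik z x powr a * ln (lik z x) * prior x)"
  shows "(Z has_real_derivative (LINT x|lborel. lik z x powr l * ln (lik z x) * prior x))
    (at l within {a..<1})"
proof -
  \<comment> \<open>The midpoint of \<open>l\<close> and 1: above \<open>l\<close>, so that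
    \<open>l\<close> can be approached from the right, and below 1, so that
    \<open>tempered_ln_integrable\<close> applies.\<close>
  define b where "b = (1 + l) / 2"
  have b: "l < b" "0 < b" "b < 1" using a by (auto simp: b_def)
  let ?w = "\<lambda>x. \<bar>lik z x powr a * ln (lik z x) * prior x\<bar> + \<bar>lik z x powr b * ln (lik z x) * prior x\<bar>"
  have "((\<lambda>s. LINT x|lborel. lik z x powr s * prior x) has_real_derivative
      (LINT x|lborel. lik z x powr l * ln (lik z x) * prior x)) (at l within {a..b})"
  proof (rule has_real_derivative_integral[where w = ?w])
    show "integrable lborel ?w"
      using int_a tempered_ln_integrable[OF b(2,3)] by auto
    show "integrable lborel (\<lambda>x. lik z x powr l * prior x)"
      using tempered_integrable a by simp
    show "((\<lambda>s. lik z x powr s * prior x) has_real_derivative lik z x powr s * ln (lik z x) * prior x)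
        (at s within {a..b})" for s x
      by (rule DERIV_cmult_right[OF has_real_derivative_powr_exponent[OF lik_pos]])
    show "\<bar>lik z x powr s * ln (lik z x) * prior x\<bar> \<le> ?w x" if "s \<in> {a..b}" for s x
      using mult_right_mono[OF powr_between_le[OF lik_pos, of a s b x] abs_ge_zero[of "ln (lik z x) * prior x"]]
        that by (simp add: abs_mult algebra_simps)
  qed (use a b in auto)
  \<comment> \<open>Near \<open>l\<close> the sets \<open>{a..b}\<close> and \<open>{a..<1}\<close>
    coincide, since \<open>l < b < 1\<close>.\<close>
  moreover have "at l within {a..b} = at l within {a..<1}"
    by (rule at_within_nhd[where S = "{..<b}"]) (use b in auto)
  ultimately show ?thesis by (simp add: transient_evidence_def[abs_def])
qed

text \<open>The base time \<open>t0\<close> supplies the lower exponent of the dominating function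
  for \<open>Z\<close>. It is taken as \<open>t / 2\<close> on the open time interval and as 0 when
  the divergence of the prior is finite.\<close>

lemma transient_flow_derivative:
  assumes t: "0 \<le> t0" "t0 \<le> t"
    and fin: "KL_finite (transient lik prior z (pseudo_time t0)) (posterior lik prior z)"
    and fin_t: "KL_finite (transient lik prior z (pseudo_time t)) (posterior lik prior z)"
  shows "((\<lambda>s. transient lik prior z (pseudo_time s) x) has_real_derivative
      - grad_KL (transient lik prior z (pseudo_time t)) (posterior lik prior z) x) (at t within {t0..})"
proof -
  define l where "l = pseudo_time t"
  define a where "a = pseudo_time t0"
  define D where "D = (LINT x|lborel. lik z x powr l * ln (lik z x) * prior x)"
  have la: "0 \<le> a" "a \<le> l" "l < 1" "a < 1" using t by (auto simp: l_def a_def pseudo_time_def)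
  have l: "0 \<le> l" "l \<le> 1" using la by auto
  have Zl: "0 < Z l" by (rule Z_pos[OF l])
  have g: "integrable lborel (\<lambda>x. lik z x powr l * ln (lik z x) * prior x)"
    using fin_t KL_finite_iff[of l] la by (simp add: l_def)
  \<comment> \<open>The derivative \<open>exp (- t)\<close> is exactly \<open>1 - l\<close>.\<close>
  have pt: "(pseudo_time has_real_derivative (1 - l)) (at t within {t0..})"
    unfolding pseudo_time_def[abs_def] l_def by (auto intro!: derivative_eq_intros)
  have "(Z has_real_derivative D) (at (pseudo_time t) within {a..<1})"
    unfolding D_def l_def[symmetric]
    by (rule Z_has_derivative[OF la(1-3)]) (use fin KL_finite_iff[of a] la in \<open>simp add: a_def\<close>)
  \<comment> \<open>Pseudo-time is increasing and stays below 1, so it maps \<open>{t0..}\<close>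
    into \<open>{a..<1}\<close>.\<close>
  then have "(Z has_real_derivative D) (at (pseudo_time t) within pseudo_time ` {t0..})"
    by (rule has_field_derivative_subset) (auto simp: a_def pseudo_time_def)
  from DERIV_image_chain[OF this pt]
  have dZ: "((\<lambda>s. Z (pseudo_time s)) has_real_derivative D * (1 - l)) (at t within {t0..})"
    by (simp add: o_def)
  have "((\<lambda>s. lik z x powr s) has_real_derivative lik z x powr l * ln (lik z x)) (at (pseudo_time t))"
    unfolding l_def by (rule has_real_derivative_powr_exponent[OF lik_pos])
  from DERIV_chain2[OF this pt]
  have dL: "((\<lambda>s. lik z x powr pseudo_time s) has_real_derivative lik z x powr l * ln (lik z x) * (1 - l))
      (at t within {t0..})" .
  \<comment> \<open>\<open>D / Z l\<close> is the mean of \<open>ln (lik z x)\<close> under the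
    transient density.\<close>
  have E: "expect (transient lik prior z l) (\<lambda>y. ln (transient lik prior z l y / posterior lik prior z y))
      = (l - 1) * (D / Z l) + ln (Z 1 / Z l)"
  proof -
    have "expect (transient lik prior z l) (\<lambda>y. ln (transient lik prior z l y / posterior lik prior z y))
      = (LINT x|lborel. (l - 1) / Z l * (lik z x powr l * ln (lik z x) * prior x)
          + ln (Z 1 / Z l) * transient lik prior z l x)"
      unfolding expect_def ln_transient_posterior[OF l]
      by (intro Bochner_Integration.integral_cong) (auto simp: transient_def algebra_simps add_divide_distrib diff_divide_distrib)
    also have "\<dots> = (l - 1) / Z l * D + ln (Z 1 / Z l) * 1"
      using g prob_densitiesD(3,4)[OF transient_prob_density[OF l]]
      unfolding D_def by simp
    finally show ?thesis by simp
  qed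
  have "((\<lambda>s. lik z x powr pseudo_time s * prior x / Z (pseudo_time s)) has_real_derivative
      ((lik z x powr l * ln (lik z x) * (1 - l) * prior x) * Z (pseudo_time t)
        - (lik z x powr pseudo_time t * prior x) * (D * (1 - l))) / (Z (pseudo_time t) * Z (pseudo_time t)))
      (at t within {t0..})"
    by (rule DERIV_divide[OF DERIV_cmult_right[OF dL] dZ]) (use Zl in \<open>simp add: l_def\<close>)
  \<comment> \<open>The constant \<open>ln (Z 1 / Z l)\<close> cancels on recentring; both sides are
    \<open>(1 - l)\<close> times the density times \<open>ln (lik z x) - D / Z l\<close>.\<close>
  moreover have "((lik z x powr l * ln (lik z x) * (1 - l) * prior x) * Z l
        - (lik z x powr l * prior x) * (D * (1 - l))) / (Z l * Z l)
      = - grad_KL (transient lik prior z l) (posterior lik prior z) x"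
    unfolding grad_KL_def unfolding E unfolding ln_transient_posterior[OF l]
    using Zl by (simp add: transient_def field_simps)
  ultimately show ?thesis by (simp add: transient_def l_def)
qed

section \<open>Continuity up to the initial time\<close>

lemma continuous_on_Z: "continuous_on {0..1} Z"
  unfolding continuous_on_sequentially o_def transient_evidence_def
proof (intro allI ballI impI)
  fix X :: "nat \<Rightarrow> real" and l :: real
  assume l: "l \<in> {0..1}" and X: "(\<forall>n. X n \<in> {0..1}) \<and> X \<longlonglongrightarrow> l"
  show "(\<lambda>n. LINT x|lborel. lik z x powr X n * prior x) \<longlonglongrightarrow> (LINT x|lborel. lik z x powr l * prior x)"
  proof (rule integral_dominated_convergence)
    show "integrable lborel (\<lambda>x. prior x + lik z x * prior x)"
      using prior_int evidence_finite by simp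
    show "AE x in lborel. (\<lambda>n. lik z x powr X n * prior x) \<longlonglongrightarrow> lik z x powr l * prior x"
      using X lik_pos by (auto intro!: tendsto_intros simp: less_imp_neq[symmetric])
    show "AE x in lborel. norm (lik z x powr X n * prior x) \<le> prior x + lik z x * prior x" for n
      using X tempered_le[of "X n"] prior_pos by (auto simp: abs_mult less_imp_le)
  qed simp_all
qed

lemma transient_0: "transient lik prior z 0 = prior"
  using lik_pos by (auto simp: transient_def Z_0 less_imp_neq[symmetric])

text \<open>This links the flow on \<open>t > 0\<close> to its initial value even if the divergence
  of the prior is infinite: continuity of \<open>Z\<close> rests on \<open>tempered_le\<close>,
  which involves no logarithm.\<close>

lemma continuous_on_transient: "continuous_on {0..} (\<lambda>t. transient lik prior z (pseudo_time t) x)"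
proof -
  have pt: "continuous_on {0..} pseudo_time"
    unfolding pseudo_time_def[abs_def] by (intro continuous_intros)
  have "continuous_on {0..} (\<lambda>t. Z (pseudo_time t))"
    by (rule continuous_on_compose2[OF continuous_on_Z pt]) (auto simp: pseudo_time_def)
  then show ?thesis
    unfolding transient_def using Z_pos lik_pos[of x]
    by (intro continuous_intros pt) (auto simp: pseudo_time_def less_imp_neq[symmetric])
qed

section \<open>The flow equation on open and closed time intervals\<close>

lemma KL_finite_transient:
  assumes "0 < t"
  shows "KL_finite (transient lik prior z (pseudo_time t)) (posterior lik prior z)"
  using assms by (subst KL_finite_iff) (auto intro!: tempered_ln_integrable simp: pseudo_time_def)

lemma transient_gradient:
  assumes "0 \<le> t" "KL_finite (transient lik prior z (pseudo_time t)) (posterior lik prior z)"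
  shows "has_fisher_rao_gradient (\<lambda>r. KL r (posterior lik prior z))
    (grad_KL (transient lik prior z (pseudo_time t)) (posterior lik prior z))
    (transient lik prior z (pseudo_time t))"
  using assms prob_densitiesD[OF transient_prob_density[of 1]]
  by (intro has_fisher_rao_gradient_KL transient_prob_density)
    (auto simp: posterior_eq_transient pseudo_time_def)

lemma transient_flow_open:
  "fisher_rao_KL_flow {0<..} (\<lambda>t. transient lik prior z (pseudo_time t)) (posterior lik prior z)"
  unfolding fisher_rao_KL_flow_def
proof (intro ballI conjI allI)
  fix t :: real and x
  assume "t \<in> {0<..}"
  then have t: "0 < t" by simp
  then show "transient lik prior z (pseudo_time t) \<in> prob_densities"
    by (intro transient_prob_density) (auto simp: pseudo_time_def)
  show "KL_finite (transient lik prior z (pseudo_time t)) (posterior lik prior z)"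
    by (rule KL_finite_transient[OF t])
  then show "has_fisher_rao_gradient (\<lambda>r. KL r (posterior lik prior z))
    (grad_KL (transient lik prior z (pseudo_time t)) (posterior lik prior z))
    (transient lik prior z (pseudo_time t))"
    using t by (intro transient_gradient) auto
  \<comment> \<open>Starting from \<open>t / 2\<close> is harmless: it lies strictly below
    \<open>t\<close>, and its divergence is finite because it is positive.\<close>
  have "at t within {t / 2..} = at t within {0<..}"
    by (rule at_within_nhd[where S = "{t / 2<..}"]) (use t in auto)
  then show "((\<lambda>s. transient lik prior z (pseudo_time s) x) has_real_derivative
      - grad_KL (transient lik prior z (pseudo_time t)) (posterior lik prior z) x) (at t within {0<..})"
    using transient_flow_derivative[of "t / 2" t x] KL_finite_transient[of "t / 2"]
      KL_finite_transient[of t] t by simp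
qed

lemma transient_flow_closed:
  assumes fin: "KL_finite prior (posterior lik prior z)"
  shows "fisher_rao_KL_flow {0..} (\<lambda>t. transient lik prior z (pseudo_time t)) (posterior lik prior z)"
  unfolding fisher_rao_KL_flow_def
proof (intro ballI conjI allI)
  have fin0: "KL_finite (transient lik prior z (pseudo_time 0)) (posterior lik prior z)"
    using fin by (simp add: pseudo_time_def transient_0)
  fix t :: real and x
  assume "t \<in> {0..}"
  then have t: "0 \<le> t" by simp
  then show "transient lik prior z (pseudo_time t) \<in> prob_densities"
    by (intro transient_prob_density) (auto simp: pseudo_time_def)
  show fin_t: "KL_finite (transient lik prior z (pseudo_time t)) (posterior lik prior z)"
    using KL_finite_transient[of t] fin0 t by (cases "t = 0") auto
  then show "has_fisher_rao_gradient (\<lambda>r. KL r (posterior lik prior z))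
    (grad_KL (transient lik prior z (pseudo_time t)) (posterior lik prior z))
    (transient lik prior z (pseudo_time t))"
    using t by (intro transient_gradient) auto
  show "((\<lambda>s. transient lik prior z (pseudo_time s) x) has_real_derivative
      - grad_KL (transient lik prior z (pseudo_time t)) (posterior lik prior z) x) (at t within {0..})"
    by (rule transient_flow_derivative[OF order_refl t fin0 fin_t])
qed

end

text \<open>The divergence of the prior from the posterior may be infinite, and then the mean in the
  gradient is undefined at time 0. Hence the equation is unconditional for \<open>t > 0\<close>,
  includes the one-sided derivative at 0 under finiteness, and continuity attaches the initial value
  in both cases.\<close>

theorem theorem3:
  fixes prior :: "real ^ 'n \<Rightarrow> real"
    and lik :: "real ^ 'm \<Rightarrow> real ^ 'n \<Rightarrow> real"
    and z :: "real ^ 'm"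
    and q :: "real \<Rightarrow> real ^ 'n \<Rightarrow> real"
  assumes prior: "prior \<in> prob_densities"
    and lik_smooth: "smooth (lik z)"
    and lik_pos: "\<And>x. 0 < lik z x"
    and evidence_finite: "integrable lborel (\<lambda>x. lik z x * prior x)"
    and q_def: "\<And>t x. q t x = transient lik prior z (pseudo_time t) x"
  shows "fisher_rao_KL_flow {0<..} q (posterior lik prior z) \<and>
         (KL_finite prior (posterior lik prior z) \<longrightarrow>
            fisher_rao_KL_flow {0..} q (posterior lik prior z)) \<and>
         q 0 = prior \<and>
         (\<forall>x. continuous_on {0..} (\<lambda>t. q t x))"
proof -
  interpret bayes lik prior z
    by unfold_locales (fact prior lik_smooth lik_pos evidence_finite)+
  have q: "q = (\<lambda>t. transient lik prior z (pseudo_time t))"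
    using q_def by auto
  show ?thesis
    unfolding q using transient_flow_open transient_flow_closed continuous_on_transient
    by (auto simp: pseudo_time_def transient_0)
qed

end
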